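(* Let $K\subseteq\mathbb{R}^n$ be a regular cone with $\dim(K)\ge 3$, let $m\ge 1$, and let $B_1,\dots,B_m,A_1,A_2,A_3$ be real symmetric $n\times n$ matrices such that $\{B_1,\dots,B_m\}$ can be generated by $\{A_1,A_2,A_3\}$, i.e. there exist real numbers $r_{ij}$ ($i=1,\dots,m$, $j=1,2,3$) with $B_i=\sum_{j=1}^3 r_{ij}A_j$ for every $i=1,\dots,m$. Suppose that for some $s_1,s_2,s_3\in\mathbb{R}$, $$s_1x^TA_1x+s_2x^TA_2x+s_3x^TA_3x>0\qquad\text{for all } x\in K,\ x\ne 0.$$ Then the following two assertions are equivalent: (e) for all $x\in K$: $\max\{x^TB_1x,\dots,x^TB_mx\}\ge 0$; (f) there exists $t\in\Delta_m$ such that for all $x\in K$: $\sum_{i=1}^m t_i\,x^TB_ix\ge 0$.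
   Context: A set $K\subseteq\mathbb{R}^n$ is a cone if for any $x\in K$, $\lambda x\in K$ holds for all $\lambda\ge 0$. A cone $K\subseteq\mathbb{R}^n$ is called a regular cone if $K\cup(-K)$ is a linear subspace of $\mathbb{R}^n$. $\dim(K)$ denotes the dimension of the linear span of $K$. $\Delta_m=\{t\in\mathbb{R}^m:\ t_i\ge 0 \text{ for all } i,\ \sum_{i=1}^m t_i=1\}$ is the standard simplex. *)

theory Defs
  imports "HOL-Analysis.Analysis"
begin

definition regular_cone :: "(real ^ 'n) set \<Rightarrow> bool" where
  "regular_cone K \<longleftrightarrow> cone K \<and> subspace (K \<union> uminus ` K)"

definition quad_form :: "real ^ 'n ^ 'n \<Rightarrow> real ^ 'n \<Rightarrow> real" where
  "quad_form A x = x \<bullet> (A *v x)"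

definition simplex_pts :: "(real ^ 'm) set" where
  "simplex_pts = {t. (\<forall>i. 0 \<le> t $ i) \<and> (\<Sum>i\<in>UNIV. t $ i) = 1}"

end

theory Submission
  imports Defs
begin

text \<open>
  The heart of the matter is that the joint range of three quadratic forms on a subspace of
  dimension at least three is convex as soon as some linear combination of them is positive
  definite (Brickman, Polyak). Given \<open>u\<close> and \<open>v\<close> in this range, the ray through \<open>u + v\<close> is cut out
  by two linear functionals \<open>l\<close> and \<open>g\<close>, where \<open>l\<close> vanishes at both \<open>u\<close> and \<open>v\<close> and \<open>g\<close> takes
  opposite values there. In dimension three, two zeros of a quadratic form can be joined, up to
  sign, inside its nonzero zeros, so the intermediate value theorem yields a common zero of the
  two forms. The theorem follows by separating the convex cone of all vectors
  \<open>(x\<^sup>TB\<^sub>1x, \<dots>, x\<^sup>TB\<^sub>mx)\<close> from the negative orthant.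
\<close>

section \<open>Algebra of quadratic forms and their polarization\<close>

lemma quad_form_scaleR: "quad_form A (c *\<^sub>R x) = c\<^sup>2 * quad_form A x"
  by (simp add: quad_form_def matrix_vector_mult_scaleR power2_eq_square)

lemma quad_form_uminus: "quad_form A (- x) = quad_form A x"
  using quad_form_scaleR[of A "-1" x] by simp

lemma quad_form_matrix_add: "quad_form (A + B) x = quad_form A x + quad_form B x"
  by (simp add: quad_form_def matrix_vector_mult_add_rdistrib inner_add_right)

lemma quad_form_matrix_scaleR: "quad_form (c *\<^sub>R A) x = c * quad_form A x"
  by (simp add: quad_form_def scaleR_matrix_vector_assoc[symmetric])

lemma continuous_on_quad_form [continuous_intros]:
  "continuous_on S f \<Longrightarrow> continuous_on S (\<lambda>t. quad_form A (f t))"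
  unfolding quad_form_def
  by (intro continuous_intros matrix_vector_mult_linear_continuous_on[THEN continuous_on_compose2]) auto

lemma symmetric_matrix_inner_commute:
  fixes A :: "real ^ 'n ^ 'n"
  assumes "transpose A = A"
  shows "x \<bullet> (A *v y) = y \<bullet> (A *v x)"
  by (metis assms dot_lmul_matrix inner_commute transpose_matrix_vector)

lemma quad_form_add:
  assumes "transpose A = A"
  shows "quad_form A (x + y) = quad_form A x + quad_form A y + 2 * (x \<bullet> (A *v y))"
  using symmetric_matrix_inner_commute[OF assms, of x y]
  by (simp add: quad_form_def matrix_vector_right_distrib inner_add_left inner_add_right)

lemma quad_form_comb2:
  assumes "transpose A = A"
  shows "quad_form A (a *\<^sub>R x + b *\<^sub>R y) =
    a\<^sup>2 * quad_form A x + b\<^sup>2 * quad_form A y + 2 * a * b * (x \<bullet> (A *v y))"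
  by (simp add: quad_form_add[OF assms] quad_form_scaleR matrix_vector_mult_scaleR)

lemma quad_form_comb3:
  assumes "transpose A = A"
  shows "quad_form A (a *\<^sub>R x + b *\<^sub>R y + c *\<^sub>R w) =
    a\<^sup>2 * quad_form A x + b\<^sup>2 * quad_form A y + c\<^sup>2 * quad_form A w
    + 2 * a * b * (x \<bullet> (A *v y)) + 2 * a * c * (x \<bullet> (A *v w)) + 2 * b * c * (y \<bullet> (A *v w))"
  by (simp add: quad_form_add[OF assms] quad_form_comb2[OF assms] quad_form_scaleR
      matrix_vector_mult_scaleR inner_add_left algebra_simps)

section \<open>Common zeros of two quadratic forms\<close>

lemma common_zero_on_path:
  fixes p :: "real \<Rightarrow> real ^ 'n"
  assumes "continuous_on {0..1} p"
    and "quad_form H (p 0) \<le> 0" "0 \<le> quad_form H (p 1)"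
    and "\<And>s. p s \<in> L" "\<And>s. p s \<noteq> 0" "\<And>s. quad_form Q (p s) = 0"
  shows "\<exists>z\<in>L. z \<noteq> 0 \<and> quad_form Q z = 0 \<and> quad_form H z = 0"
proof -
  have "\<exists>s\<ge>0. s \<le> 1 \<and> quad_form H (p s) = 0"
    by (rule IVT') (auto intro!: continuous_intros assms)
  then show ?thesis using assms(4-6) by blast
qed

text \<open>Since \<open>x\<close> and \<open>y\<close> are isotropic and orthogonal for
  \<open>Q\<close>, the form \<open>Q\<close> vanishes on all of their span, so the straight segment
  is an admissible path.\<close>

lemma common_zero_on_segment:
  fixes x y :: "real ^ 'n"
  assumes L: "subspace L" "x \<in> L" "y \<in> L" and Q: "transpose Q = Q"
    and "quad_form Q x = 0" "quad_form Q y = 0" "x \<bullet> (Q *v y) = 0"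
    and "quad_form H x \<le> 0" "0 \<le> quad_form H y"
    and "\<And>s. (1 - s) *\<^sub>R x + s *\<^sub>R y \<noteq> 0"
  shows "\<exists>z\<in>L. z \<noteq> 0 \<and> quad_form Q z = 0 \<and> quad_form H z = 0"
proof (rule common_zero_on_path[where p = "\<lambda>s. (1 - s) *\<^sub>R x + s *\<^sub>R y"])
  show "(1 - s) *\<^sub>R x + s *\<^sub>R y \<in> L" for s
    using L by (simp add: subspace_add subspace_scale)
qed (auto simp: assms quad_form_comb2[OF Q] intro!: continuous_intros)

lemma comb_nonzero:
  assumes "w \<notin> span {x, y}" "a *\<^sub>R x + b *\<^sub>R y + c *\<^sub>R w = 0"
  shows "c = 0"
proof (rule ccontr)
  assume "c \<noteq> 0"
  have "c *\<^sub>R w = - (a *\<^sub>R x + b *\<^sub>R y)"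
    using assms(2) by (metis add.commute eq_neg_iff_add_eq_0)
  also have "\<dots> \<in> span {x, y}"
    by (intro span_neg span_add span_scale) (auto intro: span_base)
  finally have "inverse c *\<^sub>R c *\<^sub>R w \<in> span {x, y}" by (rule span_scale)
  with \<open>c \<noteq> 0\<close> assms(1) show False by simp
qed

text \<open>On \<open>span {x, y, w}\<close>, with b = \<open>x \<bullet> (Q *v y)\<close> and q =
  \<open>quad_form Q w\<close>, the form \<open>Q\<close> at
  \<open>\<alpha> x + \<beta> y + \<gamma> w\<close> is
  \<open>2 b \<alpha>\<beta> + q \<gamma>\<^sup>2\<close>. If \<open>b q < 0\<close>, a conic of
  zeros runs from \<open>x\<close> to \<open>y\<close> with nonnegative \<open>\<alpha>\<close> and
  \<open>\<beta>\<close>; if \<open>q = 0\<close>, the path goes through \<open>w\<close>.\<close>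

lemma common_zero_orthogonal:
  fixes x y w :: "real ^ 'n"
  assumes L: "subspace L" "x \<in> L" "y \<in> L" "w \<in> L" and Q: "transpose Q = Q"
    and w: "w \<notin> span {x, y}" and nz: "x \<noteq> 0" "y \<noteq> 0"
    and q: "quad_form Q x = 0" "quad_form Q y = 0"
    and orth: "x \<bullet> (Q *v w) = 0" "y \<bullet> (Q *v w) = 0"
    and h: "quad_form H x \<le> 0" "0 \<le> quad_form H y"
    and sgn: "(x \<bullet> (Q *v y)) * quad_form Q w \<le> 0"
    and nd: "x \<bullet> (Q *v y) \<noteq> 0"
  shows "\<exists>z\<in>L. z \<noteq> 0 \<and> quad_form Q z = 0 \<and> quad_form H z = 0"
proof (cases "quad_form Q w = 0")
  case True
  have 1: "(1 - s) *\<^sub>R x + s *\<^sub>R w \<noteq> 0" for s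
    using comb_nonzero[OF w, of "1 - s" 0 s] nz by auto
  have 2: "(1 - s) *\<^sub>R w + s *\<^sub>R y \<noteq> 0" for s
    using comb_nonzero[OF w, of 0 s "1 - s"] nz by (auto simp: add.commute)
  show ?thesis
  \<comment> \<open>Here \<open>w\<close> is isotropic too, so \<open>Q\<close> vanishes on the
    broken line from \<open>x\<close> via \<open>w\<close> to \<open>y\<close>. The sign of
    \<open>H\<close> at \<open>w\<close> tells which of the two segments carries the sign
    change.\<close>
  proof (cases "quad_form H w \<le> 0")
    case le: True
    show ?thesis
      by (rule common_zero_on_segment[of L w y])
        (use assms True le 2 symmetric_matrix_inner_commute[OF Q, of w y] in auto)
  next
    case False
    show ?thesis
      by (rule common_zero_on_segment[of L x w]) (use assms True False 1 in auto)
  qed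
next
  case False
  \<comment> \<open>The value of \<open>k\<close> makes the \<open>w\<close> term cancel the mixed
    term of \<open>x\<close> and \<open>y\<close> along the curve with coefficients
    \<open>(1 - s)\<^sup>2\<close>, \<open>s\<^sup>2\<close>, \<open>s * (1 - s) * k\<close>. The
    radicand is positive by the sign hypothesis.\<close>
  define k where "k = sqrt (- 2 * (x \<bullet> (Q *v y)) / quad_form Q w)"
  have pos: "- 2 * (x \<bullet> (Q *v y)) / quad_form Q w > 0"
    using sgn False nd by (auto simp: zero_less_divide_iff divide_less_0_iff mult_le_0_iff)
  then have k: "k\<^sup>2 * quad_form Q w = - 2 * (x \<bullet> (Q *v y))" "k \<noteq> 0"
    using False by (auto simp: k_def)
  show ?thesis
  proof (rule common_zero_on_path[where
        p = "\<lambda>s. (1 - s)\<^sup>2 *\<^sub>R x + s\<^sup>2 *\<^sub>R y + (s * (1 - s) * k) *\<^sub>R w"])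
    fix s :: real
    show "(1 - s)\<^sup>2 *\<^sub>R x + s\<^sup>2 *\<^sub>R y + (s * (1 - s) * k) *\<^sub>R w \<in> L"
      using L by (simp add: subspace_add subspace_scale)
    show "(1 - s)\<^sup>2 *\<^sub>R x + s\<^sup>2 *\<^sub>R y + (s * (1 - s) * k) *\<^sub>R w \<noteq> 0"
    proof
      assume 0: "(1 - s)\<^sup>2 *\<^sub>R x + s\<^sup>2 *\<^sub>R y + (s * (1 - s) * k) *\<^sub>R w = 0"
      from comb_nonzero[OF w this] k have "s = 0 \<or> s = 1" by auto
      with 0 nz show False by auto
    qed
    have "quad_form Q ((1 - s)\<^sup>2 *\<^sub>R x + s\<^sup>2 *\<^sub>R y + (s * (1 - s) * k) *\<^sub>R w) =
        s\<^sup>2 * (1 - s)\<^sup>2 * (k\<^sup>2 * quad_form Q w + 2 * (x \<bullet> (Q *v y)))"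
      unfolding quad_form_comb3[OF Q] q orth by (simp add: power2_eq_square algebra_simps)
    then show "quad_form Q ((1 - s)\<^sup>2 *\<^sub>R x + s\<^sup>2 *\<^sub>R y + (s * (1 - s) * k) *\<^sub>R w) = 0"
      by (simp add: k)
  qed (auto simp: h intro!: continuous_intros)
qed

text \<open>If \<open>x\<close> and \<open>y\<close> are \<open>Q\<close>-orthogonal, the segment
  suffices. Otherwise \<open>Q\<close> is nondegenerate on their span, so a third direction in
  \<open>L\<close> can be made \<open>Q\<close>-orthogonal to both, and the sign of \<open>y\<close>
  can be chosen to suit.\<close>

lemma exists_common_zero:
  fixes x y :: "real ^ 'n"
  assumes L: "subspace L" "dim L \<ge> 3" "x \<in> L" "y \<in> L" and nz: "x \<noteq> 0" "y \<noteq> 0"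
    and Q: "transpose Q = Q"
    and q: "quad_form Q x = 0" "quad_form Q y = 0"
    and h: "quad_form H x \<le> 0" "0 \<le> quad_form H y"
  shows "\<exists>z\<in>L. z \<noteq> 0 \<and> quad_form Q z = 0 \<and> quad_form H z = 0"
proof (cases "quad_form H x = 0 \<or> quad_form H y = 0")
  case True
  then show ?thesis using assms by blast
next
  case False
  with h have h': "quad_form H x < 0" "0 < quad_form H y" by auto
  define b where "b = x \<bullet> (Q *v y)"
  show ?thesis
  proof (cases "b = 0")
    case True
    \<comment> \<open>A segment through 0 would make \<open>x\<close> and \<open>y\<close>
      proportional, yet \<open>H\<close> has strictly opposite signs at them.\<close>
    have "(1 - s) *\<^sub>R x + s *\<^sub>R y \<noteq> 0" for s
    proof
      assume "(1 - s) *\<^sub>R x + s *\<^sub>R y = 0"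
      then have e: "(1 - s) *\<^sub>R x = (- s) *\<^sub>R y" by (simp add: eq_neg_iff_add_eq_0)
      then have "(1 - s)\<^sup>2 * quad_form H x = s\<^sup>2 * quad_form H y"
        by (metis quad_form_scaleR power2_minus)
      moreover have "(1 - s)\<^sup>2 * quad_form H x \<le> 0" "s\<^sup>2 * quad_form H y \<ge> 0"
        using h by (auto simp: mult_le_0_iff)
      ultimately have "(1 - s)\<^sup>2 * quad_form H x = 0" "s\<^sup>2 * quad_form H y = 0" by linarith+
      with h' show False by simp
    qed
    then show ?thesis
      using common_zero_on_segment[of L x y Q H] assms True unfolding b_def by blast
  next
    case b: False
    have "\<not> L \<subseteq> span {x, y}"
    proof
      assume "L \<subseteq> span {x, y}"
      then have "dim L \<le> card {x, y}" by (intro dim_le_card) auto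
      also have "\<dots> \<le> 2" by (simp add: card_insert_if)
      finally show False using L by simp
    qed
    then obtain w0 where w0: "w0 \<in> L" "w0 \<notin> span {x, y}" by blast
    \<comment> \<open>This is the \<open>Q\<close>-orthogonal projection of \<open>w0\<close> onto
      \<open>span {x, y}\<close>, where \<open>Q\<close> has Gram matrix with diagonal 0 and
      off-diagonal entries \<open>b\<close>; hence the swapped coefficients and the division by
      \<open>b\<close>.\<close>
    define u where "u = ((y \<bullet> (Q *v w0)) / b) *\<^sub>R x + ((x \<bullet> (Q *v w0)) / b) *\<^sub>R y"
    define w where "w = w0 - u"
    have u: "u \<in> L" "u \<in> span {x, y}"
      unfolding u_def using L
      by (auto intro!: subspace_add subspace_scale span_add span_scale intro: span_base)
    have w: "w \<in> L" "w \<notin> span {x, y}"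
      using w0 u L span_add[of w "{x, y}" u] by (auto simp: w_def subspace_diff)
    have yx: "y \<bullet> (Q *v x) = b"
      unfolding b_def by (rule symmetric_matrix_inner_commute[OF Q])
    have orth: "x \<bullet> (Q *v w) = 0" "y \<bullet> (Q *v w) = 0"
      using b q yx unfolding w_def u_def b_def quad_form_def
      by (simp_all add: matrix_vector_mult_diff_distrib matrix_vector_right_distrib
          matrix_vector_mult_scaleR inner_diff_right inner_add_right)
    show ?thesis
    proof (cases "b * quad_form Q w \<le> 0")
      case True
      then show ?thesis
        using common_zero_orthogonal[of L x y w Q H] w orth assms b unfolding b_def by blast
    next
      case False
      \<comment> \<open>Passing to \<open>- y\<close> flips the sign of \<open>b\<close> and leaves
        the values of both forms unchanged.\<close>
      have "quad_form Q (- y) = 0" "0 \<le> quad_form H (- y)" "- y \<in> L" "- y \<noteq> 0"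
        using assms by (auto simp: quad_form_uminus subspace_neg)
      moreover have "x \<bullet> (Q *v (- y)) = - b"
        using matrix_vector_mult_scaleR[of Q "-1" y] by (simp add: b_def)
      moreover have "w \<notin> span {x, - y}"
      proof
        assume "w \<in> span {x, - y}"
        moreover have "span {x, - y} \<subseteq> span {x, y}"
          by (intro span_minimal) (auto intro: span_base span_neg)
        ultimately show False using w by blast
      qed
      ultimately show ?thesis
        using common_zero_orthogonal[of L x "- y" w Q H] w(1) orth assms b False by auto
    qed
  qed
qed

section \<open>Additivity of the joint range of three forms\<close>

lemma scaleR_of_cross3_eq_0:
  fixes u v :: "real ^ 3"
  assumes "cross3 v u = 0" "v \<noteq> 0"
  shows "\<exists>c. u = c *\<^sub>R v"
proof -
  have "collinear {0, v, u}" using assms(1) by (simp add: cross_eq_0)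
  then show ?thesis using assms(2) by (auto simp: collinear_lemma)
qed

text \<open>Both \<open>u\<close> and \<open>v\<close> are orthogonal to \<open>l\<close>, so
  \<open>cross3 v u\<close> is a multiple of \<open>l\<close>. Its inner product with
  \<open>l\<close> is, up to sign, the triple product \<open>cross3 v l \<bullet> u\<close>, so the
  multiple is zero.\<close>

lemma cross3_eq_0_of_orthogonal:
  fixes u v l :: "real ^ 3"
  assumes "l \<noteq> 0" "l \<bullet> u = 0" "l \<bullet> v = 0" "cross3 v l \<bullet> u = 0"
  shows "cross3 v u = 0"
proof -
  have "cross3 l (cross3 v u) = 0"
    using assms by (simp add: Lagrange)
  then obtain c where "cross3 v u = c *\<^sub>R l"
    using scaleR_of_cross3_eq_0 assms(1) by blast
  moreover have "l \<bullet> cross3 v u = 0"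
    using assms(4) by (metis cross_triple inner_commute cross_skew inner_minus_left
        neg_equal_0_iff_equal)
  ultimately show ?thesis using assms(1) by auto
qed

text \<open>Values in \<open>real ^ 3\<close> turn linear combinations of the forms into inner
  products and give access to the cross product.\<close>

definition quad_triple ::
  "real ^ 'n ^ 'n \<Rightarrow> real ^ 'n ^ 'n \<Rightarrow> real ^ 'n ^ 'n \<Rightarrow> real ^ 'n \<Rightarrow> real ^ 3" where
  "quad_triple A1 A2 A3 x = vector [quad_form A1 x, quad_form A2 x, quad_form A3 x]"

lemma quad_triple_scaleR: "quad_triple A1 A2 A3 (c *\<^sub>R x) = c\<^sup>2 *\<^sub>R quad_triple A1 A2 A3 x"
  by (simp add: quad_triple_def vec_eq_iff forall_3 vector_3 quad_form_scaleR)

lemma inner_quad_triple: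
  "l \<bullet> quad_triple A1 A2 A3 x =
    quad_form ((l $ 1) *\<^sub>R A1 + (l $ 2) *\<^sub>R A2 + (l $ 3) *\<^sub>R A3) x"
  by (simp add: quad_triple_def inner_vec_def sum_3 vector_3 quad_form_matrix_add
      quad_form_matrix_scaleR)

lemma quad_triple_add:
  fixes x y :: "real ^ 'n"
  assumes L: "subspace L" "dim L \<ge> 3" "x \<in> L" "y \<in> L"
    and sym: "transpose A1 = A1" "transpose A2 = A2" "transpose A3 = A3"
    and pos: "\<And>x. x \<in> L \<Longrightarrow> x \<noteq> 0 \<Longrightarrow> 0 < s \<bullet> quad_triple A1 A2 A3 x"
  shows "\<exists>z\<in>L. quad_triple A1 A2 A3 z = quad_triple A1 A2 A3 x + quad_triple A1 A2 A3 y"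
proof -
  let ?F = "quad_triple A1 A2 A3"
  have F0: "?F 0 = 0" using quad_triple_scaleR[of A1 A2 A3 0 0] by simp
  \<comment> \<open>It is enough to reach the line through \<open>v\<close>: positivity of
    \<open>s\<close> at both vectors makes the factor positive, and rescaling \<open>z\<close> by a
    square root normalizes it.\<close>
  have ray: "\<exists>z\<in>L. ?F z = v"
    if z: "z \<in> L" "z \<noteq> 0" "cross3 v (?F z) = 0" "0 < s \<bullet> v" for z v
  proof -
    have "v \<noteq> 0" using z by auto
    then obtain c where c: "?F z = c *\<^sub>R v" using scaleR_of_cross3_eq_0 z by blast
    then have "0 < c * (s \<bullet> v)" using pos z by (metis inner_scaleR_right)
    then have "0 < c" using z by (simp add: zero_less_mult_iff)
    then have "?F (sqrt (1 / c) *\<^sub>R z) = v"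
      by (simp add: quad_triple_scaleR c)
    then show ?thesis using z L by (metis subspace_scale)
  qed
  show ?thesis
  proof (cases "x = 0 \<or> y = 0")
    case True
    then show ?thesis using F0 L by auto
  next
    case False
    then have nz: "x \<noteq> 0" "y \<noteq> 0" by auto
    define v where "v = ?F x + ?F y"
    define l where "l = cross3 (?F x) (?F y)"
    have sv: "0 < s \<bullet> v"
      using pos[of x] pos[of y] nz L by (simp add: v_def inner_add_right)
    show ?thesis
    proof (cases "l = 0")
      \<comment> \<open>The two values are parallel, so \<open>y\<close> itself already lies over
        the line of \<open>v\<close>.\<close>
      case True
      then have "cross3 v (?F y) = 0"
        by (simp add: v_def l_def cross_add_left)
      then show ?thesis using ray[of y v] nz sv L by (simp add: v_def)
    next
      case l: False
      define g where "g = cross3 v l"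
      define Q where "Q = (l $ 1) *\<^sub>R A1 + (l $ 2) *\<^sub>R A2 + (l $ 3) *\<^sub>R A3"
      define H where "H = (g $ 1) *\<^sub>R A1 + (g $ 2) *\<^sub>R A2 + (g $ 3) *\<^sub>R A3"
      have qQ: "quad_form Q z = l \<bullet> ?F z" and qH: "quad_form H z = g \<bullet> ?F z" for z
        by (simp_all add: Q_def H_def inner_quad_triple)
      have symQ: "transpose Q = Q"
        using sym by (simp add: Q_def vec_eq_iff transpose_def)
      have lx: "l \<bullet> ?F x = 0" and ly: "l \<bullet> ?F y = 0"
        by (simp_all add: l_def dot_cross_self)
      \<comment> \<open>As \<open>g\<close> is orthogonal to \<open>v\<close>, its values at
        \<open>x\<close> and \<open>y\<close> are opposite; which one is nonpositive decides the
        order in which the two points are used.\<close>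
      have "g \<bullet> ?F x + g \<bullet> ?F y = 0"
        unfolding inner_add_right[symmetric] v_def[symmetric] by (simp add: g_def dot_cross_self)
      then have "\<exists>z\<in>L. z \<noteq> 0 \<and> quad_form Q z = 0 \<and> quad_form H z = 0"
        using exists_common_zero[OF L(1,2,3,4) nz symQ, of H]
          exists_common_zero[OF L(1,2,4,3) nz(2,1) symQ, of H]
        unfolding qQ qH lx ly by linarith
      then obtain z where z: "z \<in> L" "z \<noteq> 0" "l \<bullet> ?F z = 0" "g \<bullet> ?F z = 0"
        unfolding qQ qH by blast
      have "cross3 v (?F z) = 0"
        by (rule cross3_eq_0_of_orthogonal[OF l])
          (use z lx ly in \<open>auto simp: g_def v_def inner_add_right\<close>)
      then show ?thesis using ray z sv unfolding v_def by blast
    qed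
  qed
qed

section \<open>Separation and the resulting equivalence\<close>

text \<open>A Gordan-type alternative: adding the open positive orthant to \<open>C\<close> gives a
  convex set \<open>S\<close> that misses 0, and the normal of a separating hyperplane, scaled to
  total 1, is the required weight vector.\<close>

lemma convex_cone_nonneg_weights:
  fixes C :: "(real ^ 'm) set"
  assumes "convex_cone C"
    and nonneg: "\<And>u. u \<in> C \<Longrightarrow> \<exists>i. 0 \<le> u $ i"
  shows "\<exists>t\<in>simplex_pts. \<forall>u\<in>C. 0 \<le> t \<bullet> u"
proof -
  define S where "S = {v :: real ^ 'm. \<exists>u\<in>C. \<forall>i. u $ i < v $ i}"
  have C: "convex C" "0 \<in> C"
    using assms(1) by (auto simp: convex_cone_def convex_cone_contains_0)
  have "convex S"
  proof (rule convexI)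
    fix v v' :: "real ^ 'm" and a b :: real
    assume "v \<in> S" "v' \<in> S" and ab: "0 \<le> a" "0 \<le> b" "a + b = 1"
    then obtain u u' where u: "u \<in> C" "u' \<in> C" "\<And>i. u $ i < v $ i" "\<And>i. u' $ i < v' $ i"
      unfolding S_def by blast
    have "a *\<^sub>R u + b *\<^sub>R u' \<in> C"
      using C u ab by (simp add: convexD)
    moreover have "a * u $ i + b * u' $ i < a * v $ i + b * v' $ i" for i
    proof (cases "a = 0")
      case True then show ?thesis using ab u by simp
    next
      case False
      then have "a * u $ i < a * v $ i" using ab u by simp
      moreover have "b * u' $ i \<le> b * v' $ i"
        using ab less_imp_le[OF u(4)] by (intro mult_left_mono)
      ultimately show ?thesis by (rule add_less_le_mono)
    qed
    ultimately show "a *\<^sub>R v + b *\<^sub>R v' \<in> S"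
      unfolding S_def by (auto intro!: bexI[of _ "a *\<^sub>R u + b *\<^sub>R u'"])
  qed
  moreover have "0 \<notin> S"
  proof
    assume "0 \<in> S"
    then obtain u where "u \<in> C" "\<And>i. u $ i < 0" by (auto simp: S_def)
    with nonneg show False by (meson not_less)
  qed
  ultimately obtain a where a: "a \<noteq> 0" "\<And>v. v \<in> S \<Longrightarrow> 0 \<le> a \<bullet> v"
    using separating_hyperplane_set_0[of S] by blast
  \<comment> \<open>Shifting by \<open>e\<close> in every coordinate lands in \<open>S\<close>;
    letting \<open>e\<close> tend to 0 extends the inequality to points weakly above
    \<open>C\<close>. This covers \<open>C\<close> itself and, because \<open>0 \<in> C\<close>, the
    unit vectors, whence \<open>a\<close> is nonnegative.\<close>
  have above: "0 \<le> a \<bullet> v" if u: "u \<in> C" "\<And>i. u $ i \<le> v $ i" for u v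
  proof -
    have "v + e *\<^sub>R 1 \<in> S" if "0 < e" for e :: real
      unfolding S_def using u that add_le_less_mono[OF u(2), of 0 e] by (auto intro!: bexI[of _ u])
    then have le: "0 \<le> a \<bullet> v + e * (a \<bullet> 1)" if "0 < e" for e
      using a(2)[of "v + e *\<^sub>R 1"] that by (simp add: inner_add_right)
    have "((\<lambda>e. a \<bullet> v + e * (a \<bullet> 1)) \<longlongrightarrow> a \<bullet> v + 0 * (a \<bullet> 1)) (at_right 0)"
      by (intro tendsto_intros)
    then have "0 \<le> a \<bullet> v + 0 * (a \<bullet> 1)"
      by (rule tendsto_lowerbound)
        (auto intro!: eventually_at_rightI[of 0 1] le)
    then show ?thesis by simp
  qed
  have ai: "0 \<le> a $ i" for i
  proof -
    have "0 \<le> a \<bullet> axis i 1" by (rule above[OF C(2)]) (simp add: axis_def)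
    then show ?thesis by (simp add: inner_axis)
  qed
  define T where "T = (\<Sum>i\<in>UNIV. a $ i)"
  obtain j where "a $ j \<noteq> 0" using a by (auto simp: vec_eq_iff)
  then have "0 < T"
    unfolding T_def using ai by (intro sum_pos2[of _ j]) (auto simp: less_le)
  then have "(1 / T) *\<^sub>R a \<in> simplex_pts"
    using ai by (simp add: simplex_pts_def sum_divide_distrib[symmetric] T_def)
  moreover have "0 \<le> ((1 / T) *\<^sub>R a) \<bullet> u" if "u \<in> C" for u
    using above[OF that] \<open>0 < T\<close> by simp
  ultimately show ?thesis by blast
qed

theorem theorem5:
  fixes K :: "(real ^ 'n) set"
    and B :: "'m::finite \<Rightarrow> real ^ 'n ^ 'n"
    and A1 A2 A3 :: "real ^ 'n ^ 'n"
  assumes "regular_cone K"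
    and "dim K \<ge> 3"
    and "\<And>i. transpose (B i) = B i"
    and "transpose A1 = A1" and "transpose A2 = A2" and "transpose A3 = A3"
    and "\<exists>r :: real ^ 3 ^ 'm. \<forall>i.
           B i = (r $ i $ 1) *\<^sub>R A1 + (r $ i $ 2) *\<^sub>R A2 + (r $ i $ 3) *\<^sub>R A3"
    and "\<exists>s1 s2 s3 :: real. \<forall>x\<in>K. x \<noteq> 0 \<longrightarrow>
           s1 * quad_form A1 x + s2 * quad_form A2 x + s3 * quad_form A3 x > 0"
  shows "(\<forall>x\<in>K. (MAX i. quad_form (B i) x) \<ge> 0) \<longleftrightarrow>
         (\<exists>t\<in>simplex_pts. \<forall>x\<in>K. (\<Sum>i\<in>UNIV. t $ i * quad_form (B i) x) \<ge> 0)"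
proof
  let ?L = "K \<union> uminus ` K"
  let ?F = "quad_triple A1 A2 A3"
  let ?G = "\<lambda>x. \<chi> i. quad_form (B i) x"
  assume e: "\<forall>x\<in>K. 0 \<le> (MAX i. quad_form (B i) x)"
  have L: "subspace ?L" using assms(1) by (simp add: regular_cone_def)
  have dimL: "3 \<le> dim ?L" using assms(2) dim_subset[of K ?L] by simp
  obtain r :: "real ^ 3 ^ 'm" where
    r: "\<And>i. B i = (r $ i $ 1) *\<^sub>R A1 + (r $ i $ 2) *\<^sub>R A2 + (r $ i $ 3) *\<^sub>R A3"
    using assms(7) by blast
  \<comment> \<open>The values of the \<open>B i\<close> are a linear image of the triple, so
    additivity of the range passes to them.\<close>
  have GF: "?G x = r *v ?F x" for x
    by (simp add: vec_eq_iff r matrix_vector_mul_component inner_quad_triple)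
  obtain s1 s2 s3 where s: "\<And>x. x \<in> K \<Longrightarrow> x \<noteq> 0 \<Longrightarrow>
      0 < s1 * quad_form A1 x + s2 * quad_form A2 x + s3 * quad_form A3 x"
    using assms(8) by blast
  have pos: "0 < vector [s1, s2, s3] \<bullet> ?F x" if "x \<in> ?L" "x \<noteq> 0" for x
    using that s[of x] s[of "- x"]
    by (auto simp: quad_triple_def inner_vec_def sum_3 vector_3 quad_form_uminus)
  have "convex_cone (?G ` ?L)"
    unfolding convex_cone_iff
  proof (intro conjI allI impI ballI)
    have "?G 0 = 0" by (simp add: vec_eq_iff quad_form_def)
    then show "0 \<in> ?G ` ?L" using subspace_0[OF L] by (metis imageI)
  next
    fix u v assume "u \<in> ?G ` ?L" "v \<in> ?G ` ?L"
    then obtain x y where xy: "x \<in> ?L" "y \<in> ?L" "u = ?G x" "v = ?G y" by blast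
    obtain z where "z \<in> ?L" "?F z = ?F x + ?F y"
      using quad_triple_add[OF L dimL xy(1,2) assms(4-6) pos] by blast
    then show "u + v \<in> ?G ` ?L"
      unfolding xy(3,4) GF by (metis matrix_vector_right_distrib imageI)
  next
    fix u and c :: real assume "u \<in> ?G ` ?L" "0 \<le> c"
    then obtain x where x: "x \<in> ?L" "u = ?G x" by blast
    have "c *\<^sub>R u = ?G (sqrt c *\<^sub>R x)"
      using \<open>0 \<le> c\<close> by (simp add: x vec_eq_iff quad_form_scaleR)
    then show "c *\<^sub>R u \<in> ?G ` ?L" using subspace_scale[OF L x(1)] by blast
  qed
  moreover have "\<exists>i. 0 \<le> u $ i" if u: "u \<in> ?G ` ?L" for u
  proof -
    \<comment> \<open>Quadratic forms are even, so every value on \<open>?L\<close> is already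
      attained on \<open>K\<close>.\<close>
    obtain x where x: "x \<in> K" "u = ?G x"
      using u by (auto simp: quad_form_uminus)
    then have "0 \<le> (MAX i. quad_form (B i) x)" using e by blast
    then show ?thesis by (auto simp: x Max_ge_iff)
  qed
  ultimately obtain t where "t \<in> simplex_pts" "\<forall>u\<in>?G ` ?L. 0 \<le> t \<bullet> u"
    using convex_cone_nonneg_weights by blast
  then show "\<exists>t\<in>simplex_pts. \<forall>x\<in>K. 0 \<le> (\<Sum>i\<in>UNIV. t $ i * quad_form (B i) x)"
    by (auto simp: inner_vec_def)
next
  assume "\<exists>t\<in>simplex_pts. \<forall>x\<in>K. 0 \<le> (\<Sum>i\<in>UNIV. t $ i * quad_form (B i) x)"
  then obtain t :: "real ^ 'm" where t: "\<And>i. 0 \<le> t $ i" "(\<Sum>i\<in>UNIV. t $ i) = 1"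
    and f: "\<And>x. x \<in> K \<Longrightarrow> 0 \<le> (\<Sum>i\<in>UNIV. t $ i * quad_form (B i) x)"
    by (auto simp: simplex_pts_def)
  show "\<forall>x\<in>K. 0 \<le> (MAX i. quad_form (B i) x)"
  proof
    fix x assume "x \<in> K"
    then have "0 \<le> (\<Sum>i\<in>UNIV. t $ i * quad_form (B i) x)" by (rule f)
    \<comment> \<open>A weighted average with weights in the simplex never exceeds the
      maximum.\<close>
    also have "\<dots> \<le> (\<Sum>i\<in>UNIV. t $ i * (MAX i. quad_form (B i) x))"
      using t by (intro sum_mono mult_left_mono) auto
    also have "\<dots> = (MAX i. quad_form (B i) x)"
      by (simp add: t sum_distrib_right[symmetric])
    finally show "0 \<le> (MAX i. quad_form (B i) x)" .
  qed
qed

end
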